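(* Let $\mathcal H$ be a separable Hilbert space, $J$ a countable index set, $I=\{1,\dots,m\}$. For each $i\in I$ let $F_i=\{f_{ij}\}_{j\in J}$ be a frame for $\mathcal H$ with bounds $A_i,B_i$. Fix $k\in I$ and let $F_i$ be a $(\lambda_i,\mu_i)$-perturbation of $F_k$ for all $i\in I$ with $i\neq k$. If $$\sum_{i\ne k}\lambda_i<1\quad\text{and}\quad A_k>\frac{\sum_{i\ne k}\mu_i}{1-\sum_{i\ne k}\lambda_i},$$ then the family of frames $\{F_i\}_{i\in I}$ is woven.
   Context: A sequence $\{f_j\}_{j\in J}$ in $\mathcal H$ is a frame for $\mathcal H$ with lower and upper bounds $A,B>0$ if $A\|f\|^2\le\sum_{j\in J}|\langle f,f_j\rangle|^2\le B\|f\|^2$ for all $f\in\mathcal H$. For sequences $F=\{f_j\}_{j\in J}$, $G=\{g_j\}_{j\in J}$ in $\mathcal H$ and $0<\mu,\lambda<1$, $G$ is a $(\lambda,\mu)$-perturbation of $F$ if $\sum_{j\in J}|\langle f,f_j-g_j\rangle|^2\le\lambda\sum_{j\in J}|\langle f,f_j\rangle|^2+\mu\|f\|^2$ for all $f\in\mathcal H$. A partition $\{\sigma_i\}_{i\in I}$ of $J$ is a family of pairwise disjoint (possibly empty) subsets of $J$ with union $J$. A family of frames $\{F_i=\{f_{ij}\}_{j\in J}\}_{i\in I}$ is woven if there are universal constants $A,B>0$ such that for every partition $\{\sigma_i\}_{i\in I}$ of $J$ the family $\{f_{ij}\}_{j\in\sigma_i,i\in I}$ is a frame for $\mathcal H$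 with bounds $A$ and $B$. *)

theory Defs
  imports "HOL-Analysis.Analysis"
begin

text \<open>
  A commutative real normed field is isomorphic to the reals or the complex numbers (Gelfand--Mazur),
  so this class only supplies a uniform name for the conjugation; the last axiom determines it.
\<close>

class rc_field = real_normed_field +
  fixes conj :: "'a \<Rightarrow> 'a"
  assumes conj_add: "conj (x + y) = conj x + conj y"
    and conj_mult: "conj (x * y) = conj x * conj y"
    and conj_mult_self: "conj x * x = (norm x)\<^sup>2 *\<^sub>R 1"

instantiation real :: rc_field
begin
definition conj_real :: "real \<Rightarrow> real" where "conj_real x = x"
instance by standard (auto simp: conj_real_def power2_eq_square)
end

instantiation complex :: rc_field
begin
definition conj_complex :: "complex \<Rightarrow> complex" where "conj_complex = cnj"
instance
  by standard (auto simp: conj_complex_def scaleR_conv_of_real complex_norm_square mult.commute simp flip: of_real_power)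
end

text \<open>
  The space is the whole type; completeness comes from the class \<^class>\<open>banach\<close>, whose norm is
  tied to the inner product \<open>ip\<close> by \<open>ip_self\<close>.
\<close>

locale hilbert_space = vector_space scale
  for scale :: "'k::rc_field \<Rightarrow> 'a::banach \<Rightarrow> 'a" +
  fixes ip :: "'a \<Rightarrow> 'a \<Rightarrow> 'k"
  assumes scale_of_real: "scale (of_real r) x = r *\<^sub>R x"
    and ip_add_left: "ip (x + y) z = ip x z + ip y z"
    and ip_scale_left: "ip (scale c x) y = c * ip x y"
    and ip_conj_sym: "ip x y = conj (ip y x)"
    and ip_self: "ip x x = of_real ((norm x)\<^sup>2)"

locale separable_hilbert_space = hilbert_space scale ip
  for scale :: "'k::rc_field \<Rightarrow> 'a::banach \<Rightarrow> 'a" and ip :: "'a \<Rightarrow> 'a \<Rightarrow> 'k" +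
  assumes separable: "\<exists>D :: 'a set. countable D \<and> closure D = UNIV"

lemma hilbert_space_real_inner:
  "hilbert_space scaleR (inner :: 'a::{real_inner, banach} \<Rightarrow> 'a \<Rightarrow> real)"
  by unfold_locales
    (auto simp: conj_real_def inner_left_distrib inner_right_distrib inner_commute power2_norm_eq_inner
      scaleR_right_distrib scaleR_left_distrib)

lemma hilbert_space_complex: "hilbert_space (*) (\<lambda>x y :: complex. x * cnj y)"
  by unfold_locales
    (auto simp: conj_complex_def algebra_simps scaleR_conv_of_real complex_norm_square
      simp flip: of_real_power)

text \<open>
  Sums of squares are taken in \<^typ>\<open>ennreal\<close>: an unconditional sum of nonnegative terms always
  exists there, with value \<open>\<infinity>\<close> in case of divergence.
\<close>

definition coeff_sum :: "('a \<Rightarrow> 'a \<Rightarrow> 'k::real_normed_field) \<Rightarrow> 'j set \<Rightarrow> ('j \<Rightarrow> 'a) \<Rightarrow> 'a \<Rightarrow> ennreal"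
  where "coeff_sum ip J F f = (\<Sum>\<^sub>\<infinity>j\<in>J. ennreal ((norm (ip f (F j)))\<^sup>2))"

definition is_frame ::
    "('a::real_normed_vector \<Rightarrow> 'a \<Rightarrow> 'k::real_normed_field) \<Rightarrow> 'j set \<Rightarrow> ('j \<Rightarrow> 'a) \<Rightarrow> real \<Rightarrow> real \<Rightarrow> bool"
  where "is_frame ip J F A B \<longleftrightarrow> 0 < A \<and> 0 < B \<and>
    (\<forall>f. ennreal (A * (norm f)\<^sup>2) \<le> coeff_sum ip J F f \<and>
         coeff_sum ip J F f \<le> ennreal (B * (norm f)\<^sup>2))"

definition is_perturbation ::
    "('a::real_normed_vector \<Rightarrow> 'a \<Rightarrow> 'k::real_normed_field) \<Rightarrow> 'j set \<Rightarrow> real \<Rightarrow> real \<Rightarrow>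
     ('j \<Rightarrow> 'a) \<Rightarrow> ('j \<Rightarrow> 'a) \<Rightarrow> bool"
  \<comment> \<open>\<open>is_perturbation ip J l u G F\<close>: \<open>G\<close> is an \<open>(l, u)\<close>-perturbation of \<open>F\<close>.\<close>
  where "is_perturbation ip J l u G F \<longleftrightarrow> 0 < l \<and> l < 1 \<and> 0 < u \<and> u < 1 \<and>
    (\<forall>f. coeff_sum ip J (\<lambda>j. F j - G j) f
         \<le> ennreal l * coeff_sum ip J F f + ennreal (u * (norm f)\<^sup>2))"

text \<open>Unlike \<^const>\<open>partition_on\<close>, this allows empty members.\<close>

definition indexed_partition :: "'i set \<Rightarrow> 'j set \<Rightarrow> ('i \<Rightarrow> 'j set) \<Rightarrow> bool"
  where "indexed_partition I J \<sigma> \<longleftrightarrow> disjoint_family_on \<sigma> I \<and> (\<Union>i\<in>I. \<sigma> i) = J"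

definition woven ::
    "('a::real_normed_vector \<Rightarrow> 'a \<Rightarrow> 'k::real_normed_field) \<Rightarrow> 'i set \<Rightarrow> 'j set \<Rightarrow>
     ('i \<Rightarrow> 'j \<Rightarrow> 'a) \<Rightarrow> bool"
  where "woven ip I J F \<longleftrightarrow>
    (\<exists>A B. 0 < A \<and> 0 < B \<and>
      (\<forall>\<sigma>. indexed_partition I J \<sigma> \<longrightarrow>
        is_frame ip (SIGMA i:I. \<sigma> i) (\<lambda>(i, j). F i j) A B))"

end

theory Submission
  imports Defs
begin

text \<open>
  Given a partition, write \<open>a\<close> for the coefficients of \<open>f\<close> against \<open>F k\<close> and \<open>b\<close> for those against the
  woven family. Adding the perturbation inequalities over the blocks gives
  \<open>\<parallel>a - b\<parallel>\<^sup>2 \<le> L \<parallel>a\<parallel>\<^sup>2 + M \<parallel>f\<parallel>\<^sup>2 \<le> q \<parallel>a\<parallel>\<^sup>2\<close> with \<open>L = \<Sum>\<lambda>\<^sub>i\<close>, \<open>M = \<Sum>\<mu>\<^sub>i\<close> and \<open>q = L + M / A\<^sub>k < 1\<close>. Hence \<open>\<parallel>b\<parallel>\<close>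
  is bounded below by a multiple of \<open>\<parallel>a\<parallel>\<close>, and so of \<open>\<parallel>f\<parallel>\<close>, independently of the partition.
\<close>

text \<open>Multiplication by a finite constant is additive and continuous, so it commutes with the
  limit of the finite partial sums; multiplication by \<open>top\<close> would be discontinuous at
  0.\<close>

lemma infsum_cmult_right_ennreal:
  fixes f :: "'b \<Rightarrow> ennreal"
  assumes "c < top"
  shows "(\<Sum>\<^sub>\<infinity>x\<in>A. c * f x) = c * infsum f A"
proof -
  have "infsum ((*) c \<circ> f) A = c * infsum f A"
  proof (rule infsum_comm_additive_general)
    show "sum ((*) c \<circ> f) S = c * sum f S" for S
      by (simp add: sum_distrib_left)
    show "f summable_on A"
      by (simp add: nonneg_summable_on_complete)
    show "isCont ((*) c) (infsum f A)"
      unfolding isCont_def by (intro ennreal_tendsto_cmult assms tendsto_ident_at)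
  qed
  then show ?thesis by (simp add: o_def)
qed

lemma infsum_mono_set_ennreal:
  fixes f :: "'b \<Rightarrow> ennreal"
  assumes "A \<subseteq> B"
  shows "infsum f A \<le> infsum f B"
  by (rule infsum_mono_neutral) (use assms in \<open>auto simp: nonneg_summable_on_complete\<close>)

lemma infsum_Sigma_finite_ennreal:
  fixes f :: "'i \<times> 'j \<Rightarrow> ennreal"
  assumes "finite I"
  shows "infsum f (Sigma I S) = (\<Sum>i\<in>I. \<Sum>\<^sub>\<infinity>j\<in>S i. f (i, j))"
  using assms
proof induction
  case empty
  then show ?case by simp
next
  case (insert i I)
  have eq: "Sigma (insert i I) S = Pair i ` S i \<union> Sigma I S" by auto
  have "infsum f (Sigma (insert i I) S) = infsum f (Pair i ` S i) + infsum f (Sigma I S)"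
    unfolding eq
    by (rule infsum_Un_disjoint) (use insert in \<open>auto simp: nonneg_summable_on_complete\<close>)
  also have "infsum f (Pair i ` S i) = (\<Sum>\<^sub>\<infinity>j\<in>S i. f (i, j))"
    by (subst infsum_reindex) (auto simp: inj_on_def o_def)
  finally show ?case using insert by simp
qed

lemma coeff_sum_mono_set: "A \<subseteq> B \<Longrightarrow> coeff_sum ip A F f \<le> coeff_sum ip B F f"
  unfolding coeff_sum_def by (rule infsum_mono_set_ennreal)

lemma coeff_sum_Sigma:
  "finite I \<Longrightarrow> coeff_sum ip (Sigma I S) G f = (\<Sum>i\<in>I. coeff_sum ip (S i) (\<lambda>j. G (i, j)) f)"
  unfolding coeff_sum_def by (simp add: infsum_Sigma_finite_ennreal)

text \<open>\<open>snd\<close> is a bijection onto \<open>J\<close>: disjointness of the blocks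
  makes it injective, covering makes it surjective. This puts the coefficients of \<open>F k\<close>
  on the same index set as those of the woven family.\<close>

lemma coeff_sum_indexed_partition:
  assumes "indexed_partition I J \<sigma>"
  shows "coeff_sum ip (SIGMA i:I. \<sigma> i) (\<lambda>(i, j). G j) f = coeff_sum ip J G f"
proof -
  have "inj_on snd (SIGMA i:I. \<sigma> i)"
    using assms by (auto simp: inj_on_def indexed_partition_def disjoint_family_on_def)
  moreover have "snd ` (SIGMA i:I. \<sigma> i) = J"
    using assms by (force simp: indexed_partition_def image_iff)
  ultimately have "bij_betw snd (SIGMA i:I. \<sigma> i) J"
    by (simp add: bij_betw_def)
  from infsum_reindex_bij_betw[OF this] show ?thesis
    unfolding coeff_sum_def by (simp add: case_prod_unfold)
qed

text \<open>Young's inequality with a free weight. A small \<open>t\<close> brings the factor of the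
  second term close to 1; the fixed factor 2 of the case \<open>t = 1\<close> would be too large to
  absorb an error with \<open>q\<close> near 1.\<close>

lemma square_norm_add_le:
  fixes x y :: "'b::real_normed_vector" and t :: real
  assumes "0 < t"
  shows "(norm (x + y))\<^sup>2 \<le> (1 + 1 / t) * (norm x)\<^sup>2 + (1 + t) * (norm y)\<^sup>2"
proof -
  have "(norm (x + y))\<^sup>2 \<le> (norm x + norm y)\<^sup>2"
    by (simp add: norm_triangle_ineq power_mono)
  also have "\<dots> = (1 + 1 / t) * (norm x)\<^sup>2 + (1 + t) * (norm y)\<^sup>2 - (norm x - t * norm y)\<^sup>2 / t"
    using assms by (simp add: field_simps power2_eq_square)
  also have "\<dots> \<le> (1 + 1 / t) * (norm x)\<^sup>2 + (1 + t) * (norm y)\<^sup>2"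
    using assms by simp
  finally show ?thesis .
qed

context hilbert_space
begin

lemma ip_add_right: "ip x (y + z) = ip x y + ip x z"
  by (metis conj_add ip_add_left ip_conj_sym)

lemma ip_zero_right: "ip x 0 = 0"
  using ip_add_right[of x 0 0] by simp

lemma coeff_sum_zero: "coeff_sum ip J (\<lambda>j. 0) f = 0"
  by (simp add: coeff_sum_def ip_zero_right)

text \<open>A squared substitute for the triangle inequality in l2. It is summed from a pointwise
  bound in \<open>ennreal\<close>, so no convergence has to be known beforehand.\<close>

lemma coeff_sum_perturb_le:
  assumes t: "0 < t"
  shows "coeff_sum ip J F f
    \<le> ennreal (1 + 1 / t) * coeff_sum ip J G f + ennreal (1 + t) * coeff_sum ip J (\<lambda>j. F j - G j) f"
proof -
  have pointwise: "ennreal ((norm (ip f (F j)))\<^sup>2)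
      \<le> ennreal (1 + 1 / t) * ennreal ((norm (ip f (G j)))\<^sup>2)
        + ennreal (1 + t) * ennreal ((norm (ip f (F j - G j)))\<^sup>2)" for j
  proof -
    have "ip f (F j) = ip f (G j) + ip f (F j - G j)"
      using ip_add_right[of f "G j" "F j - G j"] by simp
    then show ?thesis
      using square_norm_add_le[OF t, of "ip f (G j)" "ip f (F j - G j)"] t
      by (simp add: ennreal_leI flip: ennreal_mult ennreal_plus)
  qed
  have "coeff_sum ip J F f
      \<le> (\<Sum>\<^sub>\<infinity>j\<in>J. ennreal (1 + 1 / t) * ennreal ((norm (ip f (G j)))\<^sup>2)
        + ennreal (1 + t) * ennreal ((norm (ip f (F j - G j)))\<^sup>2))"
    unfolding coeff_sum_def
    by (rule infsum_mono) (simp_all only: pointwise nonneg_summable_on_complete zero_le)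
  also have "\<dots> = (\<Sum>\<^sub>\<infinity>j\<in>J. ennreal (1 + 1 / t) * ennreal ((norm (ip f (G j)))\<^sup>2))
      + (\<Sum>\<^sub>\<infinity>j\<in>J. ennreal (1 + t) * ennreal ((norm (ip f (F j - G j)))\<^sup>2))"
    by (rule infsum_add) (simp_all only: nonneg_summable_on_complete zero_le)
  finally show ?thesis
    by (simp only: infsum_cmult_right_ennreal ennreal_less_top coeff_sum_def)
qed

end

theorem theorem2p11:
  fixes scale :: "'k::rc_field \<Rightarrow> 'a::banach \<Rightarrow> 'a"
    and ip :: "'a \<Rightarrow> 'a \<Rightarrow> 'k"
    and J :: "'j set"
    and m k :: nat
    and F :: "nat \<Rightarrow> 'j \<Rightarrow> 'a"
    and A B lam mu :: "nat \<Rightarrow> real"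
  assumes "separable_hilbert_space scale ip"
    and "countable J"
    and "\<And>i. i \<in> {1..m} \<Longrightarrow> is_frame ip J (F i) (A i) (B i)"
    and "k \<in> {1..m}"
    and "\<And>i. i \<in> {1..m} \<Longrightarrow> i \<noteq> k \<Longrightarrow> is_perturbation ip J (lam i) (mu i) (F i) (F k)"
    and "(\<Sum>i\<in>{1..m} - {k}. lam i) < 1"
    and "A k > (\<Sum>i\<in>{1..m} - {k}. mu i) / (1 - (\<Sum>i\<in>{1..m} - {k}. lam i))"
  shows "woven ip {1..m} J F"
proof -
  interpret separable_hilbert_space scale ip by fact
  note frame = assms(3) and k = assms(4) and pert = assms(5)
  let ?I = "{1..m}"
  define L where "L = (\<Sum>i\<in>?I - {k}. lam i)"
  define M where "M = (\<Sum>i\<in>?I - {k}. mu i)"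
  \<comment> \<open>Since the lower frame bound gives \<open>(norm f)^2 \<le> X / A k\<close>, where
    \<open>X\<close> is the coefficient sum of \<open>F k\<close>, the term with \<open>M\<close>
    can be charged to \<open>X\<close>. The hypothesis on \<open>A k\<close> says exactly that
    \<open>q < 1\<close>.\<close>
  define q where "q = L + M / A k"
  \<comment> \<open>Chosen to make \<open>(1 + t) * q < 1\<close>, without dividing by
    \<open>q\<close>, which is 0 when \<open>m = 1\<close>.\<close>
  define t where "t = (1 - q) / 2"
  \<comment> \<open>The factor obtained by solving
    \<open>x \<le> (1 + 1 / t) * y + (1 + t) * q * x\<close> for \<open>y\<close>.\<close>
  define c where "c = (1 - (1 + t) * q) / (1 + 1 / t)"
  have lam_pos: "0 < lam i" and mu_pos: "0 < mu i" if "i \<in> ?I - {k}" for i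
    using pert[of i] that by (auto simp: is_perturbation_def)
  have L: "0 \<le> L" "L < 1" and M: "0 \<le> M"
    unfolding L_def M_def
    by (intro sum_nonneg less_imp_le lam_pos mu_pos assms(6); assumption)+
  have Apos: "0 < A i" and Bpos: "0 < B i" if "i \<in> ?I" for i
    using frame[OF that] by (auto simp: is_frame_def)
  have Ak: "0 < A k" using Apos k by simp
  have "M < A k * (1 - L)"
    using assms(7)[folded L_def M_def] L by (simp add: pos_divide_less_eq)
  then have "M / A k < 1 - L"
    using Ak by (simp add: pos_divide_less_eq mult.commute)
  then have q: "0 \<le> q" "q < 1"
    using Ak L M by (simp_all add: q_def)
  then have t: "0 < t" by (simp add: t_def)
  have "1 - (1 + t) * q = (1 - q) * (1 - q / 2)"
    by (simp add: t_def field_simps)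
  then have c: "0 < c"
    using q t by (simp add: c_def add_pos_pos)

  have "is_frame ip (SIGMA i:?I. \<sigma> i) (\<lambda>(i, j). F i j) (c * A k) (\<Sum>i\<in>?I. B i)"
    if \<sigma>: "indexed_partition ?I J \<sigma>" for \<sigma>
    unfolding is_frame_def
  proof (intro conjI allI)
    show "0 < c * A k" using c Ak by simp
    show "0 < (\<Sum>i\<in>?I. B i)"
      using k Bpos by (intro sum_pos) auto
    fix f
    let ?X = "coeff_sum ip J (F k) f"
    let ?Y = "coeff_sum ip (SIGMA i:?I. \<sigma> i) (\<lambda>(i, j). F i j) f"
    let ?D = "coeff_sum ip (SIGMA i:?I. \<sigma> i) (\<lambda>(i, j). F k j - F i j) f"
    have sub: "\<sigma> i \<subseteq> J" if "i \<in> ?I" for i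
      using \<sigma> that unfolding indexed_partition_def by blast
    have "?Y = (\<Sum>i\<in>?I. coeff_sum ip (\<sigma> i) (F i) f)"
      by (simp add: coeff_sum_Sigma)
    also have "\<dots> \<le> (\<Sum>i\<in>?I. ennreal (B i * (norm f)\<^sup>2))"
    proof (rule sum_mono)
      fix i assume i: "i \<in> ?I"
      have "coeff_sum ip (\<sigma> i) (F i) f \<le> coeff_sum ip J (F i) f"
        by (rule coeff_sum_mono_set[OF sub[OF i]])
      also have "\<dots> \<le> ennreal (B i * (norm f)\<^sup>2)"
        using frame[OF i] by (simp add: is_frame_def)
      finally show "coeff_sum ip (\<sigma> i) (F i) f \<le> \<dots>" .
    qed
    also have "\<dots> = ennreal ((\<Sum>i\<in>?I. B i) * (norm f)\<^sup>2)"
      using Bpos[THEN less_imp_le] by (subst sum_ennreal) (simp_all add: sum_distrib_right)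
    finally show Yle: "?Y \<le> ennreal ((\<Sum>i\<in>?I. B i) * (norm f)\<^sup>2)" .

    \<comment> \<open>The upper bounds make both coefficient sums finite. Passing to reals permits
      the subtraction that absorbs the error at the end.\<close>
    obtain y where y: "?Y = ennreal y" "0 \<le> y"
      using Yle by (cases ?Y) (auto simp: top_unique)
    have Xlo: "ennreal (A k * (norm f)\<^sup>2) \<le> ?X" and Xup: "?X \<le> ennreal (B k * (norm f)\<^sup>2)"
      using frame[OF k] unfolding is_frame_def by blast+
    obtain x where x: "?X = ennreal x" "0 \<le> x"
      using Xup by (cases ?X) (auto simp: top_unique)
    have fx: "A k * (norm f)\<^sup>2 \<le> x"
      using Xlo x by (simp add: ennreal_le_iff)

    have "?D = (\<Sum>i\<in>?I. coeff_sum ip (\<sigma> i) (\<lambda>j. F k j - F i j) f)"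
      by (simp add: coeff_sum_Sigma)
    \<comment> \<open>On block \<open>k\<close> the woven family agrees with \<open>F k\<close>, so
      the difference vanishes there.\<close>
    also have "\<dots> = (\<Sum>i\<in>?I - {k}. coeff_sum ip (\<sigma> i) (\<lambda>j. F k j - F i j) f)"
      by (subst sum.remove[OF finite_atLeastAtMost k]) (simp add: coeff_sum_zero)
    also have "\<dots> \<le> (\<Sum>i\<in>?I - {k}. ennreal (lam i * x + mu i * (norm f)\<^sup>2))"
    proof (rule sum_mono)
      fix i assume i: "i \<in> ?I - {k}"
      \<comment> \<open>The perturbation inequality speaks of all of \<open>J\<close>, so the block
        is enlarged first. Every block thus costs the full \<open>x\<close>, which is why the sum of
        the \<open>lam i\<close> must stay below 1.\<close>
      have "coeff_sum ip (\<sigma> i) (\<lambda>j. F k j - F i j) f \<le> coeff_sum ip J (\<lambda>j. F k j - F i j) f"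
        using i by (intro coeff_sum_mono_set sub) auto
      also have "\<dots> \<le> ennreal (lam i) * ?X + ennreal (mu i * (norm f)\<^sup>2)"
        using pert[of i] i unfolding is_perturbation_def by blast
      also have "\<dots> = ennreal (lam i * x + mu i * (norm f)\<^sup>2)"
        using lam_pos[OF i] mu_pos[OF i] x by (simp add: ennreal_mult ennreal_plus)
      finally show "coeff_sum ip (\<sigma> i) (\<lambda>j. F k j - F i j) f \<le> \<dots>" .
    qed
    also have "\<dots> = ennreal (L * x + M * (norm f)\<^sup>2)"
      using x lam_pos[THEN less_imp_le] mu_pos[THEN less_imp_le]
      by (subst sum_ennreal) (simp_all add: L_def M_def sum.distrib sum_distrib_right)
    also have "\<dots> \<le> ennreal (q * x)"
    proof (rule ennreal_leI)
      have "M / A k * (A k * (norm f)\<^sup>2) \<le> M / A k * x"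
        using fx M Ak by (intro mult_left_mono) auto
      then show "L * x + M * (norm f)\<^sup>2 \<le> q * x"
        using Ak by (simp add: q_def distrib_right)
    qed
    finally have D: "?D \<le> ennreal (q * x)" .

    have "?X = coeff_sum ip (SIGMA i:?I. \<sigma> i) (\<lambda>(i, j). F k j) f"
      by (rule coeff_sum_indexed_partition[OF \<sigma>, symmetric])
    also have "\<dots> \<le> ennreal (1 + 1 / t) * ?Y + ennreal (1 + t) * ?D"
      using coeff_sum_perturb_le[OF t, of "SIGMA i:?I. \<sigma> i" "\<lambda>(i, j). F k j" f "\<lambda>(i, j). F i j"]
      by (simp add: case_prod_unfold)
    also have "\<dots> \<le> ennreal (1 + 1 / t) * ennreal y + ennreal (1 + t) * ennreal (q * x)"
      using D y by (intro add_mono mult_left_mono) auto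
    also have "\<dots> = ennreal ((1 + 1 / t) * y + (1 + t) * (q * x))"
      using x y t q by (simp flip: ennreal_mult ennreal_plus)
    finally have "x \<le> (1 + 1 / t) * y + (1 + t) * (q * x)"
      using x y t q by (simp add: ennreal_le_iff del: ennreal_plus)
    \<comment> \<open>The error term moves to the left; its remaining factor is positive by the
      choice of \<open>t\<close>.\<close>
    then have "(1 - (1 + t) * q) * x \<le> y * (1 + 1 / t)"
      by (simp add: algebra_simps)
    moreover have "0 < 1 + 1 / t"
      using t by (simp add: add_pos_pos)
    ultimately have "c * x \<le> y"
      unfolding c_def by (simp add: pos_divide_le_eq)
    then have "c * A k * (norm f)\<^sup>2 \<le> y"
      using mult_left_mono[OF fx less_imp_le[OF c]] by (simp only: mult.assoc)
    then show "ennreal (c * A k * (norm f)\<^sup>2) \<le> ?Y"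
      unfolding y by (rule ennreal_leI)
  qed
  moreover have "0 < c * A k" using c Ak by simp
  moreover have "0 < (\<Sum>i\<in>?I. B i)"
    using k Bpos by (intro sum_pos) auto
  ultimately show ?thesis unfolding woven_def by blast
qed

end
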